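(* Let $n=2^rp$, where $p$ is an odd prime and $r\geq 2$ is an integer. Let $X=\mathrm{Cay}(\mathbb{Z}_n,A)$ and $Y=\mathrm{Cay}(\mathbb{Z}_n,B)$, where (elements taken modulo $n$) $$A=\Big\{1+i2^r \;\Big|\; 0\leq i \leq \tfrac{p-1}{2} \Big\} \cup \Big\{1+j2^r +\tfrac{n}{2} \;\Big|\; 1 \leq j \leq \tfrac{p-1}{2} \Big\},$$ $$B = \Big\{1-i2^r \;\Big|\; 0\leq i \leq \tfrac{p-1}{2} \Big\} \cup \Big\{1-j2^r +\tfrac{n}{2} \;\Big|\; 1 \leq j \leq \tfrac{p-1}{2} \Big\}.$$ Then the graphs $X$ and $Y$ are isospectral and not isomorphic.
   Context: For $S\subseteq \mathbb{Z}_n\setminus\{0\}$, $\mathrm{Cay}(\mathbb{Z}_n, S)$ denotes the (directed) Cayley graph with vertex set $\mathbb{Z}_n$ and an arc from $x$ to $x+s$ for each $x\in\mathbb{Z}_n$, $s\in S$ (not required to satisfy $S=-S$). The spectrum of a graph is the list (multiset) of eigenvalues of its adjacency matrix; two graphs are isospectral if their spectra are the same. *)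

theory Defs
  imports
    "HOL-Number_Theory.Residues"
    "Graph_Theory.Graph_Theory"
    "Jordan_Normal_Form.Char_Poly"
begin

(* residue_ring n has carrier {0..n-1}, so a connection set S is given by canonical
   representatives. *)
definition Cay :: "int \<Rightarrow> int set \<Rightarrow> int pair_pre_digraph" where
  "Cay n S = \<lparr> pverts = carrier (residue_ring n),
    parcs = {(x, x \<oplus>\<^bsub>residue_ring n\<^esub> s) | x s. x \<in> carrier (residue_ring n) \<and> s \<in> S} \<rparr>"

(* Rows and columns are indexed by the vertices in increasing order; another enumeration would
   give a permutation-similar matrix. The entries are complex so that all eigenvalues exist. *)
definition adjacency_matrix :: "'a::linorder pair_pre_digraph \<Rightarrow> complex mat" where
  "adjacency_matrix G = (let vs = sorted_list_of_set (pverts G) in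
     mat (length vs) (length vs) (\<lambda>(i, j). if (vs ! i, vs ! j) \<in> parcs G then 1 else 0))"

(* Eigenvalues are counted with algebraic multiplicity. *)
definition graph_spectrum :: "'a::linorder pair_pre_digraph \<Rightarrow> complex multiset" where
  "graph_spectrum G = proots (char_poly (adjacency_matrix G))"

definition isospectral ::
  "'a::linorder pair_pre_digraph \<Rightarrow> 'b::linorder pair_pre_digraph \<Rightarrow> bool" where
  "isospectral G H \<longleftrightarrow> graph_spectrum G = graph_spectrum H"

end

theory Submission
  imports Defs
begin

text \<open>
  Write \<open>n = 2 c p\<close> with \<open>c = 2 ^ (r - 1)\<close> and \<open>p = 2 h + 1\<close>. Adding \<open>n div 2 = c p\<close> is the
  involution of order two, and the steps \<open>2 ^ r = 2 c\<close> run through the subgroup of order \<open>p\<close>.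
  Both connection sets have the form
  \<open>{1 + \<epsilon> i 2 c | 0 \<le> i \<le> h} \<union> {1 + \<epsilon> j 2 c + c p | 1 \<le> j \<le> h}\<close>, with \<open>\<epsilon> = 1\<close> for
  \<open>A\<close> and \<open>\<epsilon> = -1\<close> for \<open>B\<close>.

  \<^bold>\<open>Isospectral.\<close> The Fourier matrix diagonalises every circulant matrix, so the spectrum consists
  of the character sums \<open>\<lambda>\<^sub>\<epsilon>(k)\<close> over the connection set (\<open>char_poly_Cay\<close>). Let \<open>\<omega>\<close> and \<open>\<zeta>\<close> be the
  standard primitive roots of unity of orders \<open>n\<close> and \<open>p\<close>. If \<open>k\<close> is odd, the elements \<open>x\<close> and
  \<open>x + c p\<close> cancel and \<open>\<lambda>\<^sub>\<epsilon>(k) = \<omega>\<^sup>k\<close>. If \<open>k\<close> is even,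
  \<open>\<lambda>\<^sub>\<epsilon>(k) = \<omega>\<^sup>k (1 + 2 T\<^sub>\<epsilon>)\<close>, where \<open>T\<^sub>\<epsilon>\<close> is the sum of the \<open>\<zeta>\<close>-powers with exponents \<open>\<epsilon> j k\<close>
  for \<open>1 \<le> j \<le> h\<close>. If moreover \<open>p\<close> does not divide \<open>k\<close>, the two half sums add up to \<open>-1\<close>, so replacing
  \<open>\<epsilon>\<close> by \<open>-\<epsilon>\<close> changes the sign of \<open>1 + 2 T\<^sub>\<epsilon>\<close>. Replacing \<open>k\<close> by \<open>k + c p\<close> changes the sign of
  \<open>\<omega>\<^sup>k\<close>, and it preserves both conditions on \<open>k\<close> because \<open>c\<close> is even and \<open>p\<close> divides \<open>c p\<close>. Hence this
  replacement permutes the indices and carries one list of eigenvalues to the other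
  (\<open>eigenvalue_mirror\<close>).

  \<^bold>\<open>Not isomorphic.\<close> The arcs from \<open>x\<close> to \<open>x + 1\<close> can be recognised from the digraph alone: \<open>y\<close> is
  \<open>x + 1\<close> exactly when some vertex \<open>z\<close> has every out-neighbour of \<open>x\<close> except \<open>y\<close> as an
  out-neighbour. The vertex \<open>z = x + c p\<close> shows one direction, \<open>singleton_shift_difference\<close> the
  other. An isomorphism therefore commutes with adding 1, so it is a translation, and a translation
  can only be an isomorphism if the connection sets coincide (\<open>iso_conn_imp_eq\<close>). They do not:
  \<open>1 + 2 c\<close> lies in the first but not in the second.
\<close>

section \<open>Cyclic shifts\<close>

lemma bij_betw_cyclic_shift:
  fixes n c :: int
  assumes "n > 0"
  shows "bij_betw (\<lambda>k. (k + c) mod n) {0..<n} {0..<n}"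
proof (rule bij_betwI[where g = "\<lambda>k. (k - c) mod n"])
  show "(\<lambda>k. (k + c) mod n) \<in> {0..<n} \<rightarrow> {0..<n}" "(\<lambda>k. (k - c) mod n) \<in> {0..<n} \<rightarrow> {0..<n}"
    using assms by auto
qed (auto simp: mod_diff_left_eq mod_add_left_eq)

lemma sum_cyclic_shift:
  fixes n c :: int
  assumes "n > 0" and periodic: "\<And>k. f (k mod n) = f k"
  shows "(\<Sum>k\<in>{0..<n}. f (k + c)) = (\<Sum>k\<in>{0..<n}. f k)"
  using sum.reindex_bij_betw[OF bij_betw_cyclic_shift[OF assms(1)], of f c] by (simp add: periodic)

section \<open>Roots of unity\<close>

definition unity_root :: "int \<Rightarrow> int \<Rightarrow> complex" where
  "unity_root n x = cis (2 * pi * real_of_int x / real_of_int n)"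

lemma unity_root_0 [simp]: "unity_root n 0 = 1"
  by (simp add: unity_root_def)

lemma unity_root_add: "unity_root n (x + y) = unity_root n x * unity_root n y"
  by (simp add: unity_root_def cis_mult add_divide_distrib distrib_left)

lemma unity_root_scale: "c \<noteq> 0 \<Longrightarrow> unity_root (c * n) (c * x) = unity_root n x"
  by (simp add: unity_root_def mult.assoc)

lemma unity_root_eq_1_iff:
  assumes "n > 0"
  shows "unity_root n x = 1 \<longleftrightarrow> n dvd x"
proof
  assume "unity_root n x = 1"
  then have "cos (2 * pi * real_of_int x / real_of_int n) = 1"
    by (simp add: unity_root_def complex_eq_iff)
  then obtain m :: int where "2 * pi * real_of_int x / real_of_int n = of_int m * 2 * pi"
    unfolding cos_one_2pi_int by blast
  then have "real_of_int x = real_of_int (m * n)"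
    using assms by (simp add: field_simps)
  then show "n dvd x"
    unfolding of_int_eq_iff by simp
next
  assume "n dvd x"
  then obtain m where "x = n * m" ..
  then have "2 * pi * real_of_int x / real_of_int n = 2 * pi * real_of_int m"
    using assms by simp
  then show "unity_root n x = 1"
    by (simp add: unity_root_def)
qed

lemma unity_root_cong:
  assumes "n > 0" and "n dvd x - y"
  shows "unity_root n x = unity_root n y"
  using unity_root_add[of n "x - y" y] assms unity_root_eq_1_iff by simp

lemma unity_root_2: "unity_root 2 k = (if even k then 1 else -1)"
proof (cases "even k")
  case False
  then obtain l where "k = 2 * l + 1" by (elim oddE)
  moreover have "unity_root 2 (2 * l) = 1"
    by (simp add: unity_root_eq_1_iff)
  moreover have "unity_root 2 1 = -1"
    by (simp add: unity_root_def)
  ultimately show ?thesis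
    by (simp add: unity_root_add)
qed (simp add: unity_root_eq_1_iff)

text \<open>
  If \<open>n\<close> does not divide \<open>x\<close>, shifting the summation index by one multiplies the sum by a factor
  different from 1.
\<close>

lemma sum_unity_root:
  assumes "n > 0"
  shows "(\<Sum>k\<in>{0..<n}. unity_root n (k * x)) = (if n dvd x then of_int n else 0)"
proof (cases "n dvd x")
  case True
  then have "unity_root n (k * x) = 1" for k
    by (simp add: assms unity_root_eq_1_iff)
  then show ?thesis
    using True assms by simp
next
  case False
  let ?T = "\<Sum>k\<in>{0..<n}. unity_root n (k * x)"
  have periodic: "unity_root n (k mod n * x) = unity_root n (k * x)" for k
    by (rule unity_root_cong) (simp_all add: assms mod_eq_dvd_iff[symmetric] mod_mult_left_eq)
  have "?T = (\<Sum>k\<in>{0..<n}. unity_root n ((k + 1) * x))"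
    using sum_cyclic_shift[of n "\<lambda>k. unity_root n (k * x)" 1, OF assms periodic] by simp
  also have "\<dots> = ?T * unity_root n x"
    by (simp add: distrib_right unity_root_add sum_distrib_right)
  finally have "?T * (1 - unity_root n x) = 0"
    by (simp add: algebra_simps)
  then show ?thesis
    using False assms by (simp add: unity_root_eq_1_iff)
qed

section \<open>Spectra of circulant digraphs\<close>

lemma parcs_Cay_iff:
  assumes "n > 0" and "S \<subseteq> {0..<n}"
  shows "(x, y) \<in> parcs (Cay n S) \<longleftrightarrow> x \<in> {0..<n} \<and> y \<in> {0..<n} \<and> (y - x) mod n \<in> S"
proof -
  have "(y - x) mod n = s" if "y = (x + s) mod n" "s \<in> S" for s
    using that assms(2) by (auto simp: mod_diff_left_eq)
  moreover have "y = (x + (y - x) mod n) mod n" if "y \<in> {0..<n}"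
    using that by (simp add: mod_add_right_eq)
  ultimately show ?thesis
    using assms by (auto simp: Cay_def residue_ring_def)
qed

lemma pverts_Cay: "pverts (Cay n S) = {0..<n}"
  by (auto simp: Cay_def residue_ring_def)

lemma adjacency_matrix_Cay:
  assumes "n > 0" and "S \<subseteq> {0..<n}"
  shows "adjacency_matrix (Cay n S) =
    mat (nat n) (nat n) (\<lambda>(i, j). if (int j - int i) mod n \<in> S then 1 else 0)"
proof -
  have "pverts (Cay n S) = {0..n - 1}"
    by (auto simp: pverts_Cay)
  then show ?thesis
    using assms by (auto simp: adjacency_matrix_def Let_def parcs_Cay_iff intro!: eq_matI)
qed

text \<open>The eigenvalue belonging to the eigenvector \<open>i \<mapsto> unity_root n (i * k)\<close>.\<close>

definition Cay_eigenvalue :: "int \<Rightarrow> int set \<Rightarrow> int \<Rightarrow> complex" where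
  "Cay_eigenvalue n S k = (\<Sum>s\<in>S. unity_root n (s * k))"

lemma Cay_eigenvalue_mod:
  "n > 0 \<Longrightarrow> Cay_eigenvalue n S (k mod n) = Cay_eigenvalue n S k"
  unfolding Cay_eigenvalue_def
  by (intro sum.cong refl unity_root_cong) (simp_all add: mod_eq_dvd_iff[symmetric] mod_mult_right_eq)

lemma sum_lessThan_nat_int:
  "(\<Sum>i\<in>{0..<nat n}. f (int i)) = (\<Sum>k\<in>{0..<n}. f k)"
  by (rule sum.reindex_bij_betw, rule bij_betwI[where g = nat]) auto

text \<open>
  The characters of the cyclic group are common eigenvectors of all circulant matrices, and they form
  a basis because distinct characters are orthogonal. So conjugation by the matrix \<open>F\<close> of characters
  turns the adjacency matrix into a diagonal matrix \<open>D\<close>.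
\<close>

lemma char_poly_Cay:
  assumes n: "n > 0" and S: "S \<subseteq> {0..<n}"
  shows "char_poly (adjacency_matrix (Cay n S)) = (\<Prod>k\<in>{0..<n}. [:- Cay_eigenvalue n S k, 1:])"
proof -
  let ?N = "nat n"
  let ?e = "unity_root n"
  define M where "M = adjacency_matrix (Cay n S)"
  define F where "F = mat ?N ?N (\<lambda>(i, k). ?e (int i * int k))"
  define F' where "F' = mat ?N ?N (\<lambda>(k, j). ?e (- (int k * int j)) / of_int n)"
  define D where "D = mat ?N ?N (\<lambda>(i, k). if i = k then Cay_eigenvalue n S (int k) else 0)"
  have carr: "M \<in> carrier_mat ?N ?N" "F \<in> carrier_mat ?N ?N" "F' \<in> carrier_mat ?N ?N"
    "D \<in> carrier_mat ?N ?N"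
    by (simp_all add: M_def F_def F'_def D_def adjacency_matrix_Cay[OF n S])
  have FF': "F * F' = 1\<^sub>m ?N"
  proof (rule eq_matI)
    fix i j assume "i < dim_row (1\<^sub>m ?N :: complex mat)" "j < dim_col (1\<^sub>m ?N :: complex mat)"
    then have ij: "i < ?N" "j < ?N" by auto
    have "(F * F') $$ (i, j) = (\<Sum>k\<in>{0..<?N}. ?e (int i * int k) * (?e (- (int k * int j)) / of_int n))"
      using ij by (simp add: F_def F'_def scalar_prod_def)
    also have "\<dots> = (\<Sum>k\<in>{0..<?N}. ?e (int k * (int i - int j))) / of_int n"
      by (simp add: sum_divide_distrib unity_root_add[symmetric] algebra_simps)
    also have "\<dots> = (if n dvd int i - int j then of_int n else 0) / of_int n"
      by (simp only: sum_lessThan_nat_int[of "\<lambda>k. ?e (k * (int i - int j))"] sum_unity_root[OF n])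
    also have "n dvd int i - int j \<longleftrightarrow> i = j"
      using ij by (simp add: mod_eq_dvd_iff[symmetric] zless_nat_eq_int_zless)
    finally show "(F * F') $$ (i, j) = 1\<^sub>m ?N $$ (i, j)"
      using n ij by simp
  qed (simp_all add: F_def F'_def)
  then have F'F: "F' * F = 1\<^sub>m ?N"
    using mat_mult_left_right_inverse carr by blast
  have MF: "M * F = F * D"
  proof (rule eq_matI)
    fix i k assume "i < dim_row (F * D)" "k < dim_col (F * D)"
    then have ik: "i < ?N" "k < ?N" by (auto simp: F_def D_def)
    \<comment> \<open>The contribution of column \<open>j\<close> in terms of \<open>s = j - i\<close>; periodicity allows summing over \<open>s\<close>.\<close>
    let ?g = "\<lambda>s. if s mod n \<in> S then ?e ((s + int i) * int k) else 0"
    have periodic: "?g (s mod n) = ?g s" for s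
    proof -
      have "?e ((s mod n + int i) * int k) = ?e ((s + int i) * int k)"
        by (rule unity_root_cong[OF n]) (metis mod_add_left_eq mod_eq_dvd_iff mod_mult_left_eq)
      then show ?thesis by simp
    qed
    have "(M * F) $$ (i, k) = (\<Sum>j\<in>{0..<?N}. ?g (int j + - int i))"
      using ik n by (auto simp: M_def F_def adjacency_matrix_Cay[OF n S] scalar_prod_def intro!: sum.cong)
    also have "\<dots> = (\<Sum>j\<in>{0..<n}. ?g (j + - int i))"
      by (rule sum_lessThan_nat_int[of "\<lambda>j. ?g (j + - int i)" n])
    also have "\<dots> = (\<Sum>s\<in>{0..<n}. ?g s)"
      by (rule sum_cyclic_shift[of n ?g, OF n periodic])
    also have "\<dots> = (\<Sum>s\<in>{0..<n}. if s \<in> S then ?e ((s + int i) * int k) else 0)"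
      by (rule sum.cong) auto
    also have "\<dots> = (\<Sum>s\<in>S. ?e ((s + int i) * int k))"
      using S by (simp add: sum.inter_restrict[symmetric] Int_absorb1)
    also have "\<dots> = ?e (int i * int k) * Cay_eigenvalue n S (int k)"
      unfolding Cay_eigenvalue_def distrib_right unity_root_add sum_distrib_left
      by (intro sum.cong refl mult.commute)
    also have "\<dots> = (F * D) $$ (i, k)"
      using ik by (simp add: F_def D_def scalar_prod_def if_distrib sum.delta' cong: if_cong)
    finally show "(M * F) $$ (i, k) = (F * D) $$ (i, k)" .
  qed (use carr in auto)
  have "M = F * D * F'"
  proof -
    have "M = M * (F * F')" using carr FF' by simp
    also have "\<dots> = M * F * F'" using carr by (simp add: assoc_mult_mat)
    finally show ?thesis by (simp add: MF)
  qed
  then have "similar_mat M D"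
    using carr FF' F'F by (intro similar_matI[of _ _ F F' ?N]) auto
  then have "char_poly M = char_poly D"
    by (rule char_poly_similar)
  also have "\<dots> = (\<Prod>a\<leftarrow>diag_mat D. [:- a, 1:])"
    by (rule char_poly_upper_triangular[OF carr(4)]) (auto simp: upper_triangular_def D_def)
  also have "diag_mat D = map (\<lambda>i. Cay_eigenvalue n S (int i)) [0..<?N]"
    by (auto simp: diag_mat_def D_def)
  also have "(\<Prod>a\<leftarrow>\<dots>. [:- a, 1:]) = (\<Prod>i\<in>{0..<?N}. [:- Cay_eigenvalue n S (int i), 1:])"
    using prod.distinct_set_conv_list[of "[0..<?N]" "\<lambda>i. [:- Cay_eigenvalue n S (int i), 1:]"]
    by (simp add: comp_def)
  also have "\<dots> = (\<Prod>k\<in>{0..<n}. [:- Cay_eigenvalue n S k, 1:])"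
    by (rule prod.reindex_bij_betw, rule bij_betwI[where g = nat]) auto
  finally show ?thesis
    by (simp add: M_def)
qed

lemma isospectral_Cay_if_permuted_eigenvalues:
  assumes n: "n > 0" and "S \<subseteq> {0..<n}" "T \<subseteq> {0..<n}"
    and bij: "bij_betw \<pi> {0..<n} {0..<n}"
    and eq: "\<And>k. k \<in> {0..<n} \<Longrightarrow> Cay_eigenvalue n T k = Cay_eigenvalue n S (\<pi> k)"
  shows "isospectral (Cay n S) (Cay n T)"
proof -
  have "char_poly (adjacency_matrix (Cay n S)) = (\<Prod>k\<in>{0..<n}. [:- Cay_eigenvalue n S (\<pi> k), 1:])"
    using prod.reindex_bij_betw[OF bij, of "\<lambda>k. [:- Cay_eigenvalue n S k, 1:]"] assms
    by (simp add: char_poly_Cay)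
  also have "\<dots> = char_poly (adjacency_matrix (Cay n T))"
    using assms by (simp add: char_poly_Cay)
  finally show ?thesis
    by (simp add: isospectral_def graph_spectrum_def)
qed

section \<open>Isomorphisms of circulant digraphs\<close>

text \<open>
  The digraphs have no parallel arcs, so the vertex map of an isomorphism already determines its arc
  map, and the isomorphism becomes a condition on differences of vertices.
\<close>

lemma digraph_iso_CayE:
  assumes n: "n > 0" and S: "S \<subseteq> {0..<n}" and T: "T \<subseteq> {0..<n}"
    and iso: "digraph_iso (with_proj (Cay n S)) (with_proj (Cay n T))"
  obtains \<phi> where "\<phi> ` {0..<n} = {0..<n}"
    and "\<And>x y. x \<in> {0..<n} \<Longrightarrow> y \<in> {0..<n} \<Longrightarrow>
      (\<phi> y - \<phi> x) mod n \<in> T \<longleftrightarrow> (y - x) mod n \<in> S"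
proof -
  let ?G = "with_proj (Cay n S)"
  obtain f where f: "pre_digraph.digraph_isomorphism ?G f"
    and H: "with_proj (Cay n T) = app_iso f ?G"
    using iso unfolding digraph_iso_def by blast
  define \<phi> where "\<phi> = iso_verts f"
  have inj: "inj_on \<phi> {0..<n}"
    using pre_digraph.digraph_isomorphism_inj_on_verts[OF f] by (simp add: \<phi>_def pverts_Cay)
  have surj: "\<phi> ` {0..<n} = {0..<n}"
    using arg_cong[OF H, of verts] by (simp add: \<phi>_def pverts_Cay)
  have ends: "iso_arcs f (x, y) = (\<phi> x, \<phi> y)" if "(x, y) \<in> parcs (Cay n S)" for x y
    using pre_digraph.iso_verts_tail[OF f, of "(x, y)"] pre_digraph.iso_verts_head[OF f, of "(x, y)"]
      arg_cong[OF H, of tail] arg_cong[OF H, of head] that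
    by (simp add: \<phi>_def prod_eq_iff)
  have arcs: "parcs (Cay n T) = iso_arcs f ` parcs (Cay n S)"
    using arg_cong[OF H, of arcs] by simp
  have "(\<phi> x, \<phi> y) \<in> parcs (Cay n T) \<longleftrightarrow> (x, y) \<in> parcs (Cay n S)"
    if xy: "x \<in> {0..<n}" "y \<in> {0..<n}" for x y
  proof
    assume "(\<phi> x, \<phi> y) \<in> parcs (Cay n T)"
    then obtain x' y' where *: "(x', y') \<in> parcs (Cay n S)" "(\<phi> x, \<phi> y) = iso_arcs f (x', y')"
      unfolding arcs by auto
    then have "x' \<in> {0..<n}" "y' \<in> {0..<n}" "\<phi> x = \<phi> x'" "\<phi> y = \<phi> y'"
      using ends[of x' y'] by (simp_all add: parcs_Cay_iff[OF n S])
    then have "x = x'" "y = y'"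
      using inj xy by (auto dest: inj_onD)
    with * show "(x, y) \<in> parcs (Cay n S)" by simp
  next
    assume "(x, y) \<in> parcs (Cay n S)"
    then show "(\<phi> x, \<phi> y) \<in> parcs (Cay n T)"
      unfolding arcs using ends by force
  qed
  moreover have "\<phi> x \<in> {0..<n}" if "x \<in> {0..<n}" for x
    using surj that by blast
  ultimately show thesis
    using that[OF surj] by (simp add: parcs_Cay_iff[OF n S] parcs_Cay_iff[OF n T])
qed

section \<open>The two connection sets\<close>

text \<open>
  The group order is \<open>2 c p\<close> with \<open>c\<close> even and \<open>p = 2 h + 1\<close>, so that \<open>p \<ge> 3\<close>. The
  parameter \<open>h\<close> is the number of nonzero multiples of the step \<open>2 c\<close> on one side of 0.
\<close>

locale mirrored_connection_sets =
  fixes c h :: int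
  assumes c_pos: "c > 0" and c_even: "even c" and h_pos: "h \<ge> 1"
begin

definition p :: int where "p = 2 * h + 1"

definition n :: int where "n = 2 * c * p"

text \<open>
  With \<open>u\<close> read modulo 2 and \<open>i\<close> modulo \<open>p\<close>, these are coordinates on the coset of 1 modulo the
  subgroup of order \<open>2 p\<close>, the product of the subgroup of order \<open>p\<close> generated by \<open>2 c\<close> and the
  one of order 2 generated by \<open>c p\<close>.
\<close>

definition pt :: "int \<Rightarrow> int \<Rightarrow> int" where
  "pt u i = (1 + 2 * c * i + c * p * u) mod n"

text \<open>
  The values \<open>\<epsilon> = 1\<close> and \<open>\<epsilon> = -1\<close> give the two connection sets. The asymmetry between the two
  index ranges is what singles out the element 1.
\<close>

definition conn :: "int \<Rightarrow> int set" where
  "conn \<epsilon> = (\<lambda>i. pt 0 (\<epsilon> * i)) ` {0..h} \<union> (\<lambda>j. pt 1 (\<epsilon> * j)) ` {1..h}"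

lemma conn_cases [consumes 1]:
  assumes "x \<in> conn \<epsilon>"
  obtains i where "i \<in> {0..h}" "x = pt 0 (\<epsilon> * i)" | j where "j \<in> {1..h}" "x = pt 1 (\<epsilon> * j)"
  using assms unfolding conn_def by blast

lemma pt_0_in_conn: "i \<in> {0..h} \<Longrightarrow> pt 0 (\<epsilon> * i) \<in> conn \<epsilon>"
  by (simp add: conn_def)

lemma pt_1_in_conn: "j \<in> {1..h} \<Longrightarrow> pt 1 (\<epsilon> * j) \<in> conn \<epsilon>"
  by (simp add: conn_def)

lemma p_pos: "p > 0" and odd_p: "odd p"
  using h_pos by (simp_all add: p_def)

lemma n_gt_1: "n > 1"
  unfolding n_def using c_pos p_pos mult_pos_pos[of c p] by linarith

lemma n_pos: "n > 0"
  using n_gt_1 by simp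

lemma conn_subset: "conn \<epsilon> \<subseteq> {0..<n}"
  using n_pos by (auto simp: conn_def pt_def)

lemma conn_mod: "x \<in> conn \<epsilon> \<Longrightarrow> x mod n = x"
  using conn_subset[of \<epsilon>] by (auto simp: subset_iff)

lemma finite_conn: "finite (conn \<epsilon>)"
  by (simp add: conn_def)

lemma pt_0_0: "pt 0 0 = 1"
  using n_gt_1 by (simp add: pt_def)

lemma one_in_conn: "1 \<in> conn \<epsilon>"
  using pt_0_in_conn[of 0 \<epsilon>] h_pos pt_0_0 by simp

lemma pt_add_half: "(pt u i + c * p) mod n = pt (u + 1) i"
  unfolding pt_def mod_add_left_eq by (simp add: algebra_simps)

lemma pt_add_2: "pt (u + 2) i = pt u i"
proof -
  have "1 + 2 * c * i + c * p * (u + 2) = 1 + 2 * c * i + c * p * u + n"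
    by (simp add: n_def algebra_simps)
  then show ?thesis
    by (simp only: pt_def mod_add_self2)
qed

lemma pt_eqD:
  assumes "pt u i = pt v j" and "u \<in> {0, 1}" "v \<in> {0, 1}"
  shows "u = v" and "p dvd i - j"
proof -
  have "n dvd (1 + 2 * c * i + c * p * u) - (1 + 2 * c * j + c * p * v)"
    using assms(1) by (simp add: pt_def mod_eq_dvd_iff)
  also have "\<dots> = c * (2 * (i - j) + p * (u - v))"
    by (simp add: algebra_simps)
  finally have *: "2 * p dvd 2 * (i - j) + p * (u - v)"
    using c_pos by (simp add: n_def mult.assoc mult.left_commute[of 2 c])
  then have "even (2 * (i - j) + p * (u - v))"
    by (rule dvd_mult_left)
  then have "even (u - v)"
    using odd_p by simp
  then show "u = v"
    using assms(2,3) by auto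
  with * have "2 * p dvd 2 * (i - j)"
    by simp
  then show "p dvd i - j"
    by (metis dvd_times_left_cancel_iff zero_neq_numeral)
qed

lemma unit_times_index_eqD:
  assumes "\<bar>\<epsilon>\<bar> = 1" and "p dvd \<epsilon> * i - \<epsilon> * j" and "i \<in> {0..h}" "j \<in> {0..h}"
  shows "i = j"
proof -
  have "\<epsilon> dvd 1"
    using assms(1) by (simp add: zdvd1_eq)
  moreover have "p dvd \<epsilon> * (i - j)"
    using assms(2) by (simp add: right_diff_distrib)
  ultimately have "p dvd i - j"
    by (metis assms(1) abs_eq_iff' dvd_minus_iff mult_1 mult_minus_left abs_1)
  then show ?thesis
    using assms(3,4) by (simp add: mod_eq_dvd_iff[symmetric] p_def)
qed

lemma pt_inject:
  assumes "\<bar>\<epsilon>\<bar> = 1" and "pt u (\<epsilon> * i) = pt v (\<epsilon> * j)"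
    and "u \<in> {0, 1}" "v \<in> {0, 1}" "i \<in> {0..h}" "j \<in> {0..h}"
  shows "u = v" "i = j"
  using pt_eqD[OF assms(2-4)] unit_times_index_eqD[OF assms(1)] assms(5,6) by blast+

lemma sum_conn:
  assumes "\<bar>\<epsilon>\<bar> = 1"
  shows "(\<Sum>s\<in>conn \<epsilon>. f s) = (\<Sum>i\<in>{0..h}. f (pt 0 (\<epsilon> * i))) + (\<Sum>j\<in>{1..h}. f (pt 1 (\<epsilon> * j)))"
proof -
  have inj: "inj_on (\<lambda>i. pt 0 (\<epsilon> * i)) {0..h}" "inj_on (\<lambda>j. pt 1 (\<epsilon> * j)) {1..h}"
    using pt_inject(2)[OF assms] by (auto intro!: inj_onI)
  have "pt 0 (\<epsilon> * i) \<noteq> pt 1 (\<epsilon> * j)" if "i \<in> {0..h}" "j \<in> {1..h}" for i j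
    using pt_inject(1)[OF assms, of 0 i 1 j] that by auto
  then have "(\<lambda>i. pt 0 (\<epsilon> * i)) ` {0..h} \<inter> (\<lambda>j. pt 1 (\<epsilon> * j)) ` {1..h} = {}"
    by blast
  then show ?thesis
    unfolding conn_def by (simp add: sum.union_disjoint sum.reindex[OF inj(1)] sum.reindex[OF inj(2)])
qed

lemma card_conn:
  assumes "\<bar>\<epsilon>\<bar> = 1"
  shows "int (card (conn \<epsilon>)) = p"
proof -
  have "int (card (conn \<epsilon>)) = (\<Sum>s\<in>conn \<epsilon>. 1)" by simp
  also have "\<dots> = p"
    unfolding sum_conn[OF assms] using h_pos by (simp add: p_def)
  finally show ?thesis .
qed

section \<open>Isospectrality\<close>

lemma unity_root_pt:
  "unity_root n (pt u i * k) = unity_root n k * unity_root p (i * k) * unity_root 2 (u * k)"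
proof -
  have "unity_root n (pt u i * k) = unity_root n ((1 + 2 * c * i + c * p * u) * k)"
    by (rule unity_root_cong[OF n_pos]) (simp add: pt_def mod_eq_dvd_iff[symmetric] mod_mult_left_eq)
  also have "(1 + 2 * c * i + c * p * u) * k = k + 2 * c * (i * k) + c * p * (u * k)"
    by (simp add: algebra_simps)
  also have "unity_root n \<dots> =
      unity_root n k * unity_root (2 * c * p) (2 * c * (i * k)) * unity_root (c * p * 2) (c * p * (u * k))"
    by (simp add: unity_root_add n_def ac_simps)
  also have "\<dots> = unity_root n k * unity_root p (i * k) * unity_root 2 (u * k)"
    using unity_root_scale[of "2 * c" p] unity_root_scale[of "c * p" 2] c_pos p_pos by simp
  finally show ?thesis .
qed

lemma eigenvalue_conn:
  assumes "\<bar>\<epsilon>\<bar> = 1"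
  shows "Cay_eigenvalue n (conn \<epsilon>) k = unity_root n k *
    (1 + (if even k then 2 else 0) * (\<Sum>j\<in>{1..h}. unity_root p (\<epsilon> * j * k)))"
proof -
  have "{0..h} = insert 0 {1..h}"
    using h_pos by auto
  then have "Cay_eigenvalue n (conn \<epsilon>) k = unity_root n k *
      (1 + (1 + unity_root 2 k) * (\<Sum>j\<in>{1..h}. unity_root p (\<epsilon> * j * k)))"
    unfolding Cay_eigenvalue_def sum_conn[OF assms] unity_root_pt
    by (simp add: sum_distrib_left sum_distrib_right sum.distrib algebra_simps)
  then show ?thesis
    by (simp add: unity_root_2)
qed

text \<open>
  Modulo \<open>p\<close>, the indices \<open>j\<close> and \<open>-j\<close> with \<open>1 \<le> j \<le> h\<close> run through all nonzero residues, and the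
  sum over all residues vanishes.
\<close>

lemma sum_mirror_unity_root:
  assumes "\<not> p dvd k"
  shows "(\<Sum>j\<in>{1..h}. unity_root p (j * k)) + (\<Sum>j\<in>{1..h}. unity_root p (- j * k)) = -1"
proof -
  have "(\<Sum>j\<in>{1..h}. unity_root p (- j * k)) = (\<Sum>j\<in>{1..h}. unity_root p ((p - j) * k))"
    by (intro sum.cong refl unity_root_cong p_pos) (simp add: algebra_simps)
  also have "\<dots> = (\<Sum>j\<in>{h+1..<p}. unity_root p (j * k))"
    by (rule sum.reindex_bij_betw, rule bij_betwI[where g = "\<lambda>j. p - j"]) (auto simp: p_def)
  also have "(\<Sum>j\<in>{1..h}. unity_root p (j * k)) + \<dots> = (\<Sum>j\<in>{1..<p}. unity_root p (j * k))"
    by (subst sum.union_disjoint[symmetric]) (auto simp: p_def intro!: sum.cong)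
  also have "\<dots> = (\<Sum>j\<in>{0..<p}. unity_root p (j * k)) - 1"
  proof -
    have "{0..<p} = insert 0 {1..<p}"
      using p_pos by auto
    then show ?thesis by simp
  qed
  also have "\<dots> = -1"
    using assms by (simp add: sum_unity_root[OF p_pos])
  finally show ?thesis .
qed

text \<open>
  The permutation of the indices that matches the two spectra. Adding \<open>c * p\<close> negates the character
  at 1, which compensates the sign change caused by the mirroring for exactly the indices in question.
\<close>

definition half_turn :: "int \<Rightarrow> int" where
  "half_turn k = (if even k \<and> \<not> p dvd k then (k + c * p) mod n else k)"

lemma bij_half_turn: "bij_betw half_turn {0..<n} {0..<n}"
proof (rule bij_betwI[where g = half_turn])
  show "half_turn \<in> {0..<n} \<rightarrow> {0..<n}" "half_turn \<in> {0..<n} \<rightarrow> {0..<n}"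
    using n_pos by (auto simp: half_turn_def)
  have "half_turn (half_turn k) = k" if k: "k \<in> {0..<n}" for k
  proof -
    have "even ((k + c * p) mod n) \<longleftrightarrow> even k" "p dvd (k + c * p) mod n \<longleftrightarrow> p dvd k"
      using c_even by (simp_all add: n_def dvd_mod_iff)
    moreover have "((k + c * p) mod n + c * p) mod n = k"
    proof -
      have "((k + c * p) mod n + c * p) mod n = (k + n) mod n"
        unfolding mod_add_left_eq by (simp add: n_def algebra_simps)
      then show ?thesis using k by simp
    qed
    ultimately show ?thesis
      by (cases "even k \<and> \<not> p dvd k") (auto simp: half_turn_def)
  qed
  then show "half_turn (half_turn k) = k" "half_turn (half_turn k) = k" if "k \<in> {0..<n}" for k
    using that by simp_all
qed

text \<open>
  For \<open>k\<close> even and not divisible by \<open>p\<close> both factors of the eigenvalue change sign. For \<open>p dvd k\<close> the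
  half sum is insensitive to mirroring, and for odd \<open>k\<close> it does not occur.
\<close>

lemma eigenvalue_mirror:
  "Cay_eigenvalue n (conn (-1)) k = Cay_eigenvalue n (conn 1) (half_turn k)"
proof (cases "even k \<and> \<not> p dvd k")
  case True
  let ?T = "\<Sum>j\<in>{1..h}. unity_root p (j * k)" and ?T' = "\<Sum>j\<in>{1..h}. unity_root p (- j * k)"
  have "unity_root n (c * p) = -1"
    using unity_root_scale[of "c * p" 2 1] c_pos p_pos by (simp add: n_def unity_root_2 ac_simps)
  then have "unity_root n (k + c * p) = - unity_root n k"
    by (simp add: unity_root_add)
  moreover have "unity_root p (j * (k + c * p)) = unity_root p (j * k)" for j
    by (rule unity_root_cong[OF p_pos]) (simp add: algebra_simps)
  ultimately have "Cay_eigenvalue n (conn 1) (half_turn k) = - unity_root n k * (1 + 2 * ?T)"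
    using True c_even by (simp add: half_turn_def Cay_eigenvalue_mod n_pos eigenvalue_conn)
  also have "1 + 2 * ?T = - (1 + 2 * ?T')"
  proof -
    have "?T = -1 - ?T'"
      using sum_mirror_unity_root[of k] True by (simp add: eq_diff_eq)
    then show ?thesis
      by (simp only:) (simp add: algebra_simps)
  qed
  finally have "Cay_eigenvalue n (conn 1) (half_turn k) = unity_root n k * (1 + 2 * ?T')"
    by (simp only: minus_mult_minus)
  then show ?thesis
    using True eigenvalue_conn[of "-1" k] by simp
next
  case False
  have "unity_root p (- j * k) = unity_root p (j * k)" if "p dvd k" for j
    using that by (intro unity_root_cong[OF p_pos]) (simp add: algebra_simps)
  then show ?thesis
    using False by (auto simp: half_turn_def eigenvalue_conn)
qed

theorem isospectral_conn: "isospectral (Cay n (conn 1)) (Cay n (conn (-1)))"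
  by (rule isospectral_Cay_if_permuted_eigenvalues[OF n_pos conn_subset conn_subset bij_half_turn])
    (rule eigenvalue_mirror)

section \<open>Non-isomorphism\<close>

lemma conn_add_half:
  assumes "x \<in> conn \<epsilon>" and "x \<noteq> 1"
  shows "(x + c * p) mod n \<in> conn \<epsilon>"
  using assms(1)
proof (cases rule: conn_cases)
  case (1 i)
  then have "i \<in> {1..h}"
    using assms(2) pt_0_0 by (cases "i = 0") auto
  then show ?thesis
    using pt_add_half[of 0 "\<epsilon> * i"] 1(2) by (simp add: pt_1_in_conn)
next
  case (2 j)
  then show ?thesis
    using pt_add_half[of 1 "\<epsilon> * j"] pt_add_2[of 0 "\<epsilon> * j"] by (simp add: pt_0_in_conn)
qed

lemma one_add_half_notin_conn:
  assumes "\<bar>\<epsilon>\<bar> = 1"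
  shows "(1 + c * p) mod n \<notin> conn \<epsilon>"
proof
  assume "(1 + c * p) mod n \<in> conn \<epsilon>"
  moreover have *: "(1 + c * p) mod n = pt 1 (\<epsilon> * 0)"
    using pt_add_half[of 0 0] pt_0_0 by simp
  ultimately have "pt 1 (\<epsilon> * 0) \<in> conn \<epsilon>"
    by simp
  then show False
  proof (cases rule: conn_cases)
    case (1 i)
    then show False
      using pt_inject(1)[OF assms 1(2)] by simp
  next
    case (2 j)
    then show False
      using pt_inject(2)[OF assms 2(2)] h_pos by simp
  qed
qed

lemma conn_cong_1:
  assumes "x \<in> conn \<epsilon>"
  shows "c dvd x - 1"
proof -
  have pt: "c dvd pt u i - 1" for u i
  proof -
    have "pt u i mod c = (1 + 2 * c * i + c * p * u) mod c"
      unfolding pt_def by (rule mod_mod_cancel) (simp add: n_def)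
    then have "c dvd pt u i - (1 + 2 * c * i + c * p * u)"
      by (simp only: mod_eq_dvd_iff)
    then have "c dvd pt u i - (1 + 2 * c * i + c * p * u) + c * (2 * i + p * u)"
      by (rule dvd_add) simp
    also have "\<dots> = pt u i - 1"
      by (simp add: algebra_simps)
    finally show ?thesis .
  qed
  from assms show ?thesis
    by (rule conn_cases) (simp_all only: pt)
qed

text \<open>
  The recognition of the element 1. Suppose the shift by \<open>-t\<close> maps all of the connection set \<open>S\<close>
  except \<open>s\<close> into \<open>S\<close>. As it is injective, it misses exactly one \<open>s' \<in> S\<close>. Comparing the sum of \<open>S\<close>
  with the sum of its image gives \<open>s' + t - s \<equiv> p t\<close> modulo \<open>n\<close>, since \<open>S\<close> has \<open>p\<close> elements.
  All elements of \<open>S\<close> agree modulo \<open>c\<close>, so \<open>c\<close> divides \<open>t\<close> and \<open>s' + t\<close> is either \<open>s\<close> or \<open>s + c p\<close>.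
  If \<open>s \<noteq> 1\<close>, then \<open>s + c p\<close> lies in \<open>S\<close> as well, and either case contradicts the choice of \<open>s\<close> or
  of \<open>s'\<close>.
\<close>

lemma singleton_shift_difference:
  assumes \<epsilon>: "\<bar>\<epsilon>\<bar> = 1" and s: "s \<in> conn \<epsilon>" "(s - t) mod n \<notin> conn \<epsilon>"
    and others: "\<And>a. a \<in> conn \<epsilon> \<Longrightarrow> a \<noteq> s \<Longrightarrow> (a - t) mod n \<in> conn \<epsilon>"
  shows "s = 1"
proof (rule ccontr)
  assume "s \<noteq> 1"
  let ?S = "conn \<epsilon>"
  let ?sh = "\<lambda>a. (a - t) mod n"
  have inj: "inj_on ?sh ?S"
  proof (rule inj_onI)
    fix a b assume "a \<in> ?S" "b \<in> ?S" "?sh a = ?sh b"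
    then have "a mod n = b mod n"
      by (simp add: mod_eq_dvd_iff)
    with \<open>a \<in> ?S\<close> \<open>b \<in> ?S\<close> show "a = b"
      by (simp add: conn_mod)
  qed
  let ?R = "?S - {s}"
  have inj': "inj_on ?sh ?R"
    using inj by (rule inj_on_subset) auto
  have sub: "?sh ` ?R \<subseteq> ?S"
    using others by auto
  have card_R: "int (card ?R) = p - 1"
    using card_Suc_Diff1[OF finite_conn s(1)] card_conn[OF \<epsilon>] by linarith
  have "card (?S - ?sh ` ?R) = card ?S - card ?R"
    using sub inj' finite_conn by (simp add: card_Diff_subset card_image)
  also have "\<dots> = 1"
    using card_R card_conn[OF \<epsilon>] by linarith
  finally obtain s' where s': "?S - ?sh ` ?R = {s'}"
    by (auto simp: card_1_singleton_iff)
  have "\<Sum>?S = \<Sum>(?S - ?sh ` ?R) + \<Sum>(?sh ` ?R)"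
    by (rule sum.subset_diff[OF sub finite_conn])
  also have "\<dots> = s' + (\<Sum>a\<in>?R. ?sh a)"
    by (simp add: s' sum.reindex[OF inj'])
  finally have "s + \<Sum>?R = s' + (\<Sum>a\<in>?R. ?sh a)"
    using s(1) finite_conn by (simp add: sum.remove)
  then have "(s + \<Sum>?R) mod n = (s' + (\<Sum>a\<in>?R. ?sh a) mod n) mod n"
    by (simp only: mod_add_right_eq)
  also have "\<dots> = (s' + (\<Sum>a\<in>?R. a - t)) mod n"
    by (simp only: mod_sum_eq mod_add_right_eq)
  also have "(\<Sum>a\<in>?R. a - t) = \<Sum>?R - (p - 1) * t"
    using card_R by (simp add: sum_subtractf)
  finally have "n dvd (s + \<Sum>?R) - (s' + (\<Sum>?R - (p - 1) * t))"
    by (simp only: mod_eq_dvd_iff)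
  also have "\<dots> = p * t - (s' + t - s)"
    by (simp add: algebra_simps)
  finally have sum_eq: "n dvd p * t - (s' + t - s)" .
  have "c dvd t"
  proof -
    have "card ?R \<noteq> 0"
      using card_R h_pos unfolding p_def by linarith
    then have "?R \<noteq> {}"
      by (metis card.empty)
    then obtain a where a: "a \<in> ?S" "?sh a \<in> ?S"
      using others by blast
    have "c dvd ?sh a - (a - t)"
      by (rule dvd_trans[of _ n]) (simp_all add: n_def mod_eq_dvd_iff[symmetric])
    then have "c dvd (a - 1) - (?sh a - 1) + (?sh a - (a - t))"
      by (rule dvd_add[OF dvd_diff[OF conn_cong_1[OF a(1)] conn_cong_1[OF a(2)]]])
    then show ?thesis by simp
  qed
  then obtain w where w: "t = c * w" ..
  have "(s' + t) mod n \<in> {s, (s + c * p) mod n}"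
  proof -
    obtain v where v: "p * t - (s' + t - s) = n * v"
      using sum_eq by blast
    have *: "s' + t = s + c * p * (w - 2 * v)"
      using v by (simp add: w n_def algebra_simps)
    show ?thesis
    proof (cases "even w")
      case True
      then obtain l where "w = 2 * l" ..
      then have "s' + t = s + n * (l - v)"
        using * by (simp add: n_def algebra_simps)
      then show ?thesis
        using conn_mod[OF s(1)] by simp
    next
      case False
      then obtain l where "w = 2 * l + 1" by (elim oddE)
      then have "s' + t = s + c * p + n * (l - v)"
        using * by (simp add: n_def algebra_simps)
      then show ?thesis
        by simp
    qed
  qed
  moreover have shift_back: "?sh ((s' + t) mod n) = s'"
    using s' conn_subset[of \<epsilon>] by (auto simp: mod_diff_left_eq)
  moreover have "s' \<in> ?S"
    using s' by auto
  ultimately have "(s' + t) mod n = (s + c * p) mod n" "(s' + t) mod n \<noteq> s"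
    using s(2) by auto
  then have "(s' + t) mod n \<in> ?R"
    using conn_add_half[OF s(1) \<open>s \<noteq> 1\<close>] by simp
  then have "s' \<in> ?sh ` ?R"
    using shift_back by (metis imageI)
  then show False
    using s' by blast
qed

text \<open>
  The out-neighbours of \<open>x\<close> that are not out-neighbours of \<open>x + c p\<close> are just \<open>x + 1\<close>. An isomorphism
  carries this property to the other digraph, where it again characterises adding 1. So the vertex
  map is a translation.
\<close>

lemma iso_conn_imp_eq:
  assumes \<epsilon>: "\<bar>\<epsilon>\<bar> = 1" and \<delta>: "\<bar>\<delta>\<bar> = 1"
    and iso: "digraph_iso (with_proj (Cay n (conn \<epsilon>))) (with_proj (Cay n (conn \<delta>)))"
  shows "conn \<epsilon> = conn \<delta>"
proof -
  obtain \<phi> where surj: "\<phi> ` {0..<n} = {0..<n}"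
    and arc: "\<And>x y. x \<in> {0..<n} \<Longrightarrow> y \<in> {0..<n} \<Longrightarrow>
      (\<phi> y - \<phi> x) mod n \<in> conn \<delta> \<longleftrightarrow> (y - x) mod n \<in> conn \<epsilon>"
    by (rule digraph_iso_CayE[OF n_pos conn_subset conn_subset iso]) (rule that)
  have step: "\<phi> ((x + 1) mod n) = (\<phi> x + 1) mod n" if x: "x \<in> {0..<n}" for x
  proof -
    let ?y = "(x + 1) mod n" and ?z = "(x + c * p) mod n"
    let ?s = "(\<phi> ?y - \<phi> x) mod n" and ?t = "\<phi> ?z - \<phi> x"
    have yz: "?y \<in> {0..<n}" "?z \<in> {0..<n}"
      using n_pos by auto
    have half: "(a - c * p) mod n = (a + c * p) mod n" for a
    proof -
      have "a + c * p = (a - c * p) + n"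
        by (simp add: n_def)
      then show ?thesis
        by (simp only: mod_add_self2)
    qed
    have from_z: "(b - ?z) mod n = ((b - x) mod n + c * p) mod n" for b
    proof -
      have "(b - ?z) mod n = ((b - x) - c * p) mod n"
        by (simp add: mod_diff_right_eq algebra_simps)
      then show ?thesis
        unfolding half by (simp add: mod_add_left_eq)
    qed
    have y_x: "(?y - x) mod n = 1"
      using n_gt_1 by (simp add: mod_diff_left_eq)
    have "?s = 1"
    proof (rule singleton_shift_difference[OF \<delta>])
      show "?s \<in> conn \<delta>"
        using arc[OF x yz(1)] y_x one_in_conn by simp
      have "(?y - ?z) mod n \<notin> conn \<epsilon>"
        using one_add_half_notin_conn[OF \<epsilon>] by (simp only: from_z y_x) simp
      then show "(?s - ?t) mod n \<notin> conn \<delta>"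
        using arc[OF yz(2,1)] by (simp add: mod_diff_left_eq)
    next
      fix a assume a: "a \<in> conn \<delta>" "a \<noteq> ?s"
      have "(\<phi> x + a) mod n \<in> \<phi> ` {0..<n}"
        unfolding surj using n_pos by simp
      then obtain b where b: "b \<in> {0..<n}" "\<phi> b = (\<phi> x + a) mod n"
        by force
      have a_eq: "a = (\<phi> b - \<phi> x) mod n"
        using a(1) conn_subset[of \<delta>] by (auto simp: b(2) mod_diff_left_eq)
      then have "(b - x) mod n \<in> conn \<epsilon>"
        using arc[OF x b(1)] a(1) by simp
      moreover have "(b - x) mod n \<noteq> 1"
      proof
        assume "(b - x) mod n = 1"
        then have "b = ?y"
          using b(1) mod_add_right_eq[of x "b - x" n] by simp
        then show False
          using a(2) a_eq by simp
      qed
      ultimately have "(b - ?z) mod n \<in> conn \<epsilon>"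
        unfolding from_z by (rule conn_add_half)
      then show "(a - ?t) mod n \<in> conn \<delta>"
        using arc[OF yz(2) b(1)] by (simp add: a_eq mod_diff_left_eq)
    qed
    then have "(\<phi> ?y - \<phi> x + \<phi> x) mod n = (1 + \<phi> x) mod n"
      using mod_add_left_eq[of "\<phi> ?y - \<phi> x" n "\<phi> x"] mod_add_left_eq[of 1 n "\<phi> x"] by simp
    moreover have "\<phi> ?y \<in> {0..<n}"
      using surj yz(1) by blast
    ultimately show ?thesis
      by (simp add: add.commute)
  qed
  have translation: "k < n \<longrightarrow> \<phi> k = (\<phi> 0 + k) mod n" if "k \<ge> 0" for k
    using that
  proof (induction k rule: int_ge_induct)
    case base
    have "\<phi> 0 \<in> {0..<n}"
      using surj n_pos by auto
    then show ?case by simp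
  next
    case (step k)
    show ?case
    proof
      assume "k + 1 < n"
      then show "\<phi> (k + 1) = (\<phi> 0 + (k + 1)) mod n"
        using step \<open>\<And>x. x \<in> {0..<n} \<Longrightarrow> \<phi> ((x + 1) mod n) = (\<phi> x + 1) mod n\<close>[of k]
        by (simp add: mod_add_left_eq add.assoc)
    qed
  qed
  have same: "a \<in> conn \<epsilon> \<longleftrightarrow> a \<in> conn \<delta>" if a: "a \<in> {0..<n}" for a
    using arc[of 0 a] translation[of a] a n_pos by (simp add: mod_diff_left_eq)
  show ?thesis
  proof (rule Set.set_eqI)
    fix a
    show "a \<in> conn \<epsilon> \<longleftrightarrow> a \<in> conn \<delta>"
      using same[of a] conn_subset[of \<epsilon>] conn_subset[of \<delta>] by blast
  qed
qed

text \<open>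
  If \<open>1 + 2 c\<close> were also of the mirrored form, then \<open>1 \<equiv> -i\<close> modulo \<open>p\<close> for some \<open>0 \<le> i \<le> h\<close>, but
  \<open>0 < 1 + i < p\<close>.
\<close>

lemma conn_mirror_neq: "conn 1 \<noteq> conn (-1)"
proof
  assume "conn 1 = conn (-1)"
  moreover have "pt 0 1 \<in> conn 1"
    using pt_0_in_conn[of 1 1] h_pos by simp
  ultimately have "pt 0 1 \<in> conn (-1)"
    by simp
  then obtain u i where "pt 0 1 = pt u (- i)" "u \<in> {0, 1}" and i: "0 \<le> i" "i \<le> h"
    by (cases rule: conn_cases) auto
  then have "p dvd 1 + i"
    using pt_eqD(2)[of 0 1 u "- i"] by simp
  then show False
    using zdvd_imp_le[of p "1 + i"] h_pos i by (simp add: p_def)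
qed

theorem not_iso_conn: "\<not> digraph_iso (with_proj (Cay n (conn 1))) (with_proj (Cay n (conn (-1))))"
  using iso_conn_imp_eq[of 1 "-1"] conn_mirror_neq by auto

end

section \<open>Order a power of two times an odd prime\<close>

theorem theorem3p1:
  fixes n p :: int and r :: nat and A B :: "int set" and X Y :: "int pair_pre_digraph"
  assumes "prime p" and "odd p" and "r \<ge> 2" and "n = 2 ^ r * p"
    and "A = {(1 + i * 2 ^ r) mod n | i. 0 \<le> i \<and> i \<le> (p - 1) div 2}
           \<union> {(1 + j * 2 ^ r + n div 2) mod n | j. 1 \<le> j \<and> j \<le> (p - 1) div 2}"
    and "B = {(1 - i * 2 ^ r) mod n | i. 0 \<le> i \<and> i \<le> (p - 1) div 2}
           \<union> {(1 - j * 2 ^ r + n div 2) mod n | j. 1 \<le> j \<and> j \<le> (p - 1) div 2}"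
    and "X = Cay n A" and "Y = Cay n B"
  shows "isospectral X Y \<and> \<not> digraph_iso (with_proj X) (with_proj Y)"
proof -
  define c :: int where "c = 2 ^ (r - 1)"
  define h where "h = (p - 1) div 2"
  have "p > 1"
    using assms(1) by (rule prime_gt_1_int)
  interpret L: mirrored_connection_sets c h
    by unfold_locales (use assms(2,3) \<open>p > 1\<close> in \<open>auto simp: c_def h_def elim!: oddE\<close>)
  have pow: "2 ^ r = 2 * c"
    using assms(3) by (simp add: c_def flip: power_Suc)
  have "2 * h + 1 = p"
    using assms(2) by (auto simp: h_def elim!: oddE)
  then have p: "L.p = p"
    by (simp add: L.p_def)
  have n: "L.n = n"
    by (simp add: L.n_def p pow assms(4))
  have half: "n div 2 = c * p"
    by (simp add: assms(4) pow)
  have "A = L.conn 1"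
    by (auto simp: assms(5) L.conn_def L.pt_def image_def n p half pow h_def[symmetric] ac_simps)
  moreover have "B = L.conn (-1)"
    by (auto simp: assms(6) L.conn_def L.pt_def image_def n p half pow h_def[symmetric] ac_simps)
  ultimately show ?thesis
    using L.isospectral_conn L.not_iso_conn by (simp add: assms(7,8) n)
qed

end
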